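(* Let $M,R\ge1$ be integers, $\epsilon>0$, $\sigma>0$. Let $\mu^i\in\mathcal P(\mathcal X^i)$, $i\in[M]$, let $\nu\in\mathcal P(\mathcal Z)$ with $\mathcal Z\subseteq\mathbb R^{d_z}$ be $4$-sub-Weibull with parameter $\sigma^2$, and let $K$ satisfy the Kernel Assumption of the context. Then $$S^R_\epsilon(\{\mu^i\}_{i=1}^M,\nu)=\inf_{A\in\mathbb R^{R\times d_z}}\Big\{2\|A\|_F^2+\sum_{i=1}^M \mathrm{OT}^i_{A,m_\Phi,\epsilon}(\mu^i,\nu)\Big\}.$$ Moreover, the infimum is achieved at some $A^*\in\mathcal A_M:=\{A\in\mathbb R^{R\times d_z}:\|A\|_F\le M\kappa(2\sigma^2)^{1/4}\}$.
   Context: Setting. $[M]=\{1,\dots,M\}$; $\mathcal X^i$ ($i\in[M]$) are feature spaces (subsets of Euclidean spaces, possibly of different dimensions), $\mathcal X=\bigsqcup_{i=1}^M\mathcal X^i$ is their disjoint union, $\mathcal Z\subseteq\mathbb R^{d_z}$, and $\mathcal P(\cdot)$ denotes Borel probability measures. $\Gamma(\mu,\nu)$ is the set of couplings of $\mu$ and $\nu$; $D_{\mathrm{KL}}$ is the Kullback–Leibler divergence; $\langle\cdot,\cdot\rangle_F,\|\cdot\|_F$ are the Frobenius inner product and norm. A probability measure $\nu$ on $\mathbb R^{d}$ is $4$-sub-Weibull with parameter $\sigma^2$ if $\int\exp(\|z\|^4/(2\sigma^2))\,d\nu(z)\le 2$. Kernel Assumption. $K:\mathcal X\times\mathcal X\to\mathbb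 R_{\ge0}$ is symmetric positive semidefinite and, with $\rho=\frac1M\sum_{i=1}^M\mu^i$, admits a Mercer decomposition $K(x,x')=\sum_{r\ge1}\lambda_r\phi'_r(x)\phi'_r(x')$ for all $x,x'\in\mathcal X$, where $\lambda_r\ge0$ and $\{\phi'_r\}$ are orthonormal in $L^2(\rho)$ and are eigenfunctions, with eigenvalues $\lambda_r$, of $T_Kf=\int K(\cdot,x')f(x')\,d\rho(x')$. Put $\phi_r=\sqrt{\lambda_r}\,\phi'_r$ and $\Phi_R(x)=(\phi_1(x),\dots,\phi_R(x))^\top\in\mathbb R^R$. (1) There is $\kappa>0$ with $K(x,x)\le\kappa^2$ for all $x\in\mathcal X$ (hence $\|\Phi_R(x)\|\le\kappa$). (2) $\eta_R:=\sup_{x\in\mathcal X}\sum_{r>R}\phi_r(x)^2\to0$ as $R\to\infty$. Rank-$R$ objective. $$S^R_\epsilon(\{\mu^i\},\nu)=\inf_{\pi^i\in\Gamma(\mu^i,\nu),\,i\in[M]}\Big\{\sum_{i,j=1}^M\iint \Phi_R(x)^\top\Phi_R(x')\|z-z'\|^2\,d\pi^i(x,z)\,d\pi^j(x',z')+\epsilon\sum_{i=1}^M D_{\mathrm{KL}}(\pi^i\|\mu^i\otimes\nu)\Big\}.$$ Lifted problems. $m_\Phi=\sum_{j=1}^M\int_{\mathcal X^j}\Phi_R(x')\,d\mu^j(x')\in\mathbb R^R$; for $A\in\mathbb R^{R\times d_z}$, $x\in\mathcal X^i$, $z\in\mathcal Z$, $$c^i_{A,m_\Phi}(x,z)=2\,\Phi_R(x)^\top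 m_\Phi\,\|z\|^2-4\langle A,\Phi_R(x)z^\top\rangle_F,$$ $$\mathrm{OT}^i_{A,m_\Phi,\epsilon}(\mu^i,\nu)=\inf_{\pi^i\in\Gamma(\mu^i,\nu)}\Big\{\int c^i_{A,m_\Phi}\,d\pi^i+\epsilon D_{\mathrm{KL}}(\pi^i\|\mu^i\otimes\nu)\Big\}.$$ *)

theory Defs
  imports "HOL-Probability.Probability" "HOL-Library.Extended_Nat"
begin

text \<open>
  The feature spaces live in Euclidean spaces whose dimension depends on the index \<open>i\<close>, so
  \<open>\<real>\<^sup>n\<close> is modelled by the extensional functions on \<open>{..<n}\<close>. For finite \<open>n\<close> the product
  sigma algebra below is the Borel sigma algebra of \<open>\<real>\<^sup>n\<close>.
\<close>

definition euclid :: "nat \<Rightarrow> (nat \<Rightarrow> real) measure" where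
  "euclid n = (\<Pi>\<^sub>M k\<in>{..<n}. (borel :: real measure))"

text \<open>
  Probability measures on a subset \<open>S\<close> of a space with sigma algebra \<open>B\<close>. The set \<open>S\<close> need not
  be measurable: if \<open>B\<close> is a Borel sigma algebra, its trace on \<open>S\<close> is the Borel sigma algebra
  of the subspace topology.
\<close>

definition prob_on :: "'a measure \<Rightarrow> 'a set \<Rightarrow> 'a measure set" where
  "prob_on B S = {\<mu>. prob_space \<mu> \<and> sets \<mu> = sets (restrict_space B S)}"

definition disjoint_union :: "nat \<Rightarrow> (nat \<Rightarrow> 'a set) \<Rightarrow> (nat \<times> 'a) set" where
  "disjoint_union M X = (SIGMA i:{1..M}. X i)"

text \<open>
  The measure \<open>\<rho> = (\<mu>\<^sup>1 + \<dots> + \<mu>\<^sup>M) / M\<close> on the disjoint union. A set is measurable iff each of its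
  slices is, which is the Borel sigma algebra of the disjoint union topology.
\<close>

definition average_measure :: "nat \<Rightarrow> (nat \<Rightarrow> 'a measure) \<Rightarrow> (nat \<times> 'a) measure" where
  "average_measure M \<mu> =
     measure_of (disjoint_union M (\<lambda>i. space (\<mu> i)))
       {B. B \<subseteq> disjoint_union M (\<lambda>i. space (\<mu> i)) \<and> (\<forall>i\<in>{1..M}. Pair i -` B \<in> sets (\<mu> i))}
       (\<lambda>B. (\<Sum>i=1..M. emeasure (\<mu> i) (Pair i -` B)) / of_nat M)"

definition couplings :: "'a measure \<Rightarrow> 'b measure \<Rightarrow> ('a \<times> 'b) measure set" where
  "couplings \<mu> \<nu> = {\<pi>. prob_space \<pi> \<and> sets \<pi> = sets (\<mu> \<Otimes>\<^sub>M \<nu>) \<and>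
                      distr \<pi> \<mu> fst = \<mu> \<and> distr \<pi> \<nu> snd = \<nu>}"

text \<open>
  The library's \<open>KL_divergence b Q P\<close> is the divergence of \<open>P\<close> from \<open>Q\<close> as a real number, with
  junk values when \<open>P\<close> is not absolutely continuous or the log-density is not integrable. For
  probability measures with \<open>P \<lless> Q\<close> the negative part of the log-density is always
  \<open>P\<close>-integrable, so in the second case the divergence is \<open>\<infinity>\<close>, too.
\<close>

definition D_KL :: "'a measure \<Rightarrow> 'a measure \<Rightarrow> ereal" where
  "D_KL P Q =
     (if absolutely_continuous Q P \<and> integrable P (entropy_density (exp 1) Q P)
      then ereal (KL_divergence (exp 1) Q P) else \<infinity>)"

definition four_sub_Weibull :: "real \<Rightarrow> 'z::real_normed_vector measure \<Rightarrow> bool" where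
  "four_sub_Weibull \<sigma>2 \<nu> \<longleftrightarrow> (\<integral>\<^sup>+z. ennreal (exp (norm z ^ 4 / (2 * \<sigma>2))) \<partial>\<nu>) \<le> 2"

definition psd_kernel_on :: "'x set \<Rightarrow> ('x \<Rightarrow> 'x \<Rightarrow> real) \<Rightarrow> bool" where
  "psd_kernel_on S K \<longleftrightarrow>
     (\<forall>x\<in>S. \<forall>y\<in>S. K x y = K y x) \<and>
     (\<forall>(n::nat) (p :: nat \<Rightarrow> 'x) (c :: nat \<Rightarrow> real). (\<forall>k<n. p k \<in> S) \<longrightarrow>
        (\<Sum>k<n. \<Sum>l<n. c k * c l * K (p k) (p l)) \<ge> 0)"

definition integral_operator ::
    "'x measure \<Rightarrow> ('x \<Rightarrow> 'x \<Rightarrow> real) \<Rightarrow> ('x \<Rightarrow> real) \<Rightarrow> 'x \<Rightarrow> real" where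
  "integral_operator \<rho> K f x = (\<integral>y. K x y * f y \<partial>\<rho>)"

text \<open>
  The sequences are indexed from 1 on. The number \<open>N\<close> of eigenfunctions may be finite, since
  \<open>L\<^sup>2(\<rho>)\<close> is finite-dimensional for finitely supported \<open>\<rho>\<close>. In that case the eigenvalues are
  padded with zeros, and \<open>ef r\<close> is irrelevant for \<open>r > N\<close>. For \<open>N = \<infinity>\<close> the whole sequence is
  orthonormal. The eigenvalue equation is one in \<open>L\<^sup>2(\<rho>)\<close>, hence holds almost everywhere.
\<close>

definition mercer_decomposition ::
    "'x measure \<Rightarrow> 'x set \<Rightarrow> ('x \<Rightarrow> 'x \<Rightarrow> real) \<Rightarrow> (nat \<Rightarrow> real) \<Rightarrow> (nat \<Rightarrow> 'x \<Rightarrow> real) \<Rightarrow> bool" where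
  "mercer_decomposition \<rho> S K lam ef \<longleftrightarrow>
     (\<forall>r\<ge>1. lam r \<ge> 0) \<and>
     (\<exists>N::enat.
        (\<forall>r. N < enat r \<longrightarrow> lam r = 0) \<and>
        (\<forall>r\<ge>1. enat r \<le> N \<longrightarrow>
           ef r \<in> borel_measurable \<rho> \<and> integrable \<rho> (\<lambda>x. (ef r x)\<^sup>2) \<and>
           (AE x in \<rho>. integral_operator \<rho> K (ef r) x = lam r * ef r x)) \<and>
        (\<forall>r\<ge>1. \<forall>s\<ge>1. enat r \<le> N \<longrightarrow> enat s \<le> N \<longrightarrow>
           (\<integral>x. ef r x * ef s x \<partial>\<rho>) = (if r = s then 1 else 0))) \<and>
     (\<forall>x\<in>S. \<forall>y\<in>S. (\<lambda>n. lam (Suc n) * ef (Suc n) x * ef (Suc n) y) sums K x y)"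

definition feature :: "(nat \<Rightarrow> real) \<Rightarrow> (nat \<Rightarrow> 'x \<Rightarrow> real) \<Rightarrow> nat \<Rightarrow> 'x \<Rightarrow> real" where
  "feature lam ef r x = sqrt (lam r) * ef r x"

definition tail_sup :: "'x set \<Rightarrow> (nat \<Rightarrow> 'x \<Rightarrow> real) \<Rightarrow> nat \<Rightarrow> ennreal" where
  "tail_sup S \<phi> R = (SUP x\<in>S. \<Sum>n. ennreal ((\<phi> (R + 1 + n) x)\<^sup>2))"

definition kernel_assumption ::
    "nat \<Rightarrow> (nat \<Rightarrow> 'a set) \<Rightarrow> (nat \<Rightarrow> 'a measure) \<Rightarrow> (nat \<times> 'a \<Rightarrow> nat \<times> 'a \<Rightarrow> real) \<Rightarrow>
     (nat \<Rightarrow> real) \<Rightarrow> (nat \<Rightarrow> nat \<times> 'a \<Rightarrow> real) \<Rightarrow> real \<Rightarrow> bool" where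
  "kernel_assumption M X \<mu> K lam ef \<kappa> \<longleftrightarrow>
     (let S = disjoint_union M X in
       (\<forall>x\<in>S. \<forall>y\<in>S. K x y \<ge> 0) \<and>
       psd_kernel_on S K \<and>
       mercer_decomposition (average_measure M \<mu>) S K lam ef \<and>
       \<kappa> > 0 \<and> (\<forall>x\<in>S. K x x \<le> \<kappa>\<^sup>2) \<and>
       tail_sup S (feature lam ef) \<longlonglongrightarrow> 0)"

text \<open>
  \<open>R \<times> d\<close> matrices, given by their rows \<open>1, \<dots>, R\<close> in \<open>\<real>\<^sup>d\<close>; extensionality makes the
  representation unique.
\<close>

definition matrices :: "nat \<Rightarrow> (nat \<Rightarrow> real ^ 'd) set" where
  "matrices R = ({1..R} \<rightarrow>\<^sub>E UNIV)"

definition frob_inner :: "nat \<Rightarrow> (nat \<Rightarrow> real ^ 'd) \<Rightarrow> (nat \<Rightarrow> real ^ 'd) \<Rightarrow> real" where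
  "frob_inner R A B = (\<Sum>r=1..R. \<Sum>k\<in>UNIV. A r $ k * B r $ k)"

definition frob_norm :: "nat \<Rightarrow> (nat \<Rightarrow> real ^ 'd) \<Rightarrow> real" where
  "frob_norm R A = sqrt (frob_inner R A A)"

definition outer :: "nat \<Rightarrow> (nat \<Rightarrow> real) \<Rightarrow> real ^ 'd \<Rightarrow> nat \<Rightarrow> real ^ 'd" where
  "outer R v z = (\<lambda>r\<in>{1..R}. \<chi> k. v r * z $ k)"

definition rank_objective ::
    "nat \<Rightarrow> nat \<Rightarrow> real \<Rightarrow> (nat \<Rightarrow> nat \<times> 'a \<Rightarrow> real) \<Rightarrow> (nat \<Rightarrow> 'a measure) \<Rightarrow>
     (real ^ 'd) measure \<Rightarrow> ereal" where
  "rank_objective M R \<epsilon> \<phi> \<mu> \<nu> =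
     (INF \<pi> \<in> (\<Pi>\<^sub>E i\<in>{1..M}. couplings (\<mu> i) \<nu>).
        ereal (\<Sum>i=1..M. \<Sum>j=1..M.
          \<integral>(x', z'). (\<integral>(x, z). (\<Sum>r=1..R. \<phi> r (i, x) * \<phi> r (j, x')) * (norm (z - z'))\<^sup>2 \<partial>\<pi> i) \<partial>\<pi> j)
        + ereal \<epsilon> * (\<Sum>i=1..M. D_KL (\<pi> i) (\<mu> i \<Otimes>\<^sub>M \<nu>)))"

definition mean_feature ::
    "nat \<Rightarrow> (nat \<Rightarrow> nat \<times> 'a \<Rightarrow> real) \<Rightarrow> (nat \<Rightarrow> 'a measure) \<Rightarrow> nat \<Rightarrow> real" where
  "mean_feature M \<phi> \<mu> r = (\<Sum>j=1..M. \<integral>x. \<phi> r (j, x) \<partial>\<mu> j)"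

definition lifted_cost ::
    "nat \<Rightarrow> (nat \<Rightarrow> nat \<times> 'a \<Rightarrow> real) \<Rightarrow> (nat \<Rightarrow> real ^ 'd) \<Rightarrow> (nat \<Rightarrow> real) \<Rightarrow>
     nat \<Rightarrow> 'a \<Rightarrow> real ^ 'd \<Rightarrow> real" where
  "lifted_cost R \<phi> A m i x z =
     2 * (\<Sum>r=1..R. \<phi> r (i, x) * m r) * (norm z)\<^sup>2
       - 4 * frob_inner R A (outer R (\<lambda>r. \<phi> r (i, x)) z)"

definition lifted_OT ::
    "nat \<Rightarrow> real \<Rightarrow> (nat \<Rightarrow> nat \<times> 'a \<Rightarrow> real) \<Rightarrow> (nat \<Rightarrow> real ^ 'd) \<Rightarrow> (nat \<Rightarrow> real) \<Rightarrow>
     nat \<Rightarrow> 'a measure \<Rightarrow> (real ^ 'd) measure \<Rightarrow> ereal" where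
  "lifted_OT R \<epsilon> \<phi> A m i \<mu> \<nu> =
     (INF \<pi> \<in> couplings \<mu> \<nu>.
        ereal (\<integral>(x, z). lifted_cost R \<phi> A m i x z \<partial>\<pi>) + ereal \<epsilon> * D_KL \<pi> (\<mu> \<Otimes>\<^sub>M \<nu>))"

definition lifted_objective ::
    "nat \<Rightarrow> nat \<Rightarrow> real \<Rightarrow> (nat \<Rightarrow> nat \<times> 'a \<Rightarrow> real) \<Rightarrow> (nat \<Rightarrow> 'a measure) \<Rightarrow>
     (real ^ 'd) measure \<Rightarrow> (nat \<Rightarrow> real ^ 'd) \<Rightarrow> ereal" where
  "lifted_objective M R \<epsilon> \<phi> \<mu> \<nu> A =
     ereal (2 * (frob_norm R A)\<^sup>2)
       + (\<Sum>i=1..M. lifted_OT R \<epsilon> \<phi> A (mean_feature M \<phi> \<mu>) i (\<mu> i) \<nu>)"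

end

theory Submission
  imports Defs
begin

text \<open>
  Expand \<open>\<parallel>z - z'\<parallel>\<^sup>2 = \<parallel>z\<parallel>\<^sup>2 + \<parallel>z'\<parallel>\<^sup>2 - 2 z \<bullet> z'\<close> in the interaction energy of the couplings \<open>\<pi>\<^sup>i\<close>. In
  a term with \<open>\<parallel>z\<parallel>\<^sup>2\<close> the other coupling enters only through the feature mean of its first
  marginal, which is prescribed, so these terms are linear in \<open>\<pi>\<close>. The mixed terms add up to
  \<open>- 2 \<parallel>B\<parallel>\<^sup>2\<close>, where \<open>B\<close> is the sum over \<open>i\<close> of the matrices \<open>\<integral> \<Phi>(x) z\<^sup>T d\<pi>\<^sup>i\<close>
  (\<open>quadratic_objective_eq\<close>). This concave function of \<open>\<pi>\<close> is an infimum of affine ones: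
  \<open>- 2 \<parallel>B\<parallel>\<^sup>2\<close> is the minimum over \<open>A\<close> of \<open>2 \<parallel>A\<parallel>\<^sup>2 - 4 \<langle>A, B\<rangle>\<close>, attained at \<open>A = B\<close>
  (\<open>frob_complete_square\<close>). Hence the rank-\<open>R\<close> problem minimises a joint cost of \<open>A\<close> and \<open>\<pi>\<close>.
  For fixed \<open>A\<close> this cost is a sum of terms each involving one \<open>\<pi>\<^sup>i\<close>, so that its infimum over
  \<open>\<pi>\<close> is the sum of the lifted transport problems (\<open>lifted_objective_eq_INF\<close>). Taking the two
  infima in either order proves the identity.

  Attainment is a matter of compactness in \<open>A\<close> alone. The moment bound on \<open>\<nu>\<close> and
  \<open>\<parallel>\<Phi>(x)\<parallel> \<le> \<kappa>\<close> put every cross moment matrix \<open>B\<close> into the ball of radius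
  \<open>M \<kappa> (2 \<sigma>\<^sup>2)\<^bsup>1/4\<^esup>\<close>, so the infimum over all matrices equals the infimum over this compact ball.
  The cost of a fixed coupling is affine in \<open>A\<close> with a slope bounded independently of the
  coupling, so the lifted problems are Lipschitz in \<open>A\<close> (\<open>OT_lipschitz\<close>) and a continuous
  function is minimised over a compact set.
\<close>

section \<open>Matrices given by their rows\<close>

lemma frob_inner_eq_sum_inner: "frob_inner R A B = (\<Sum>r=1..R. A r \<bullet> B r)"
  unfolding frob_inner_def by (simp add: inner_vec_def)

lemma frob_norm_eq_L2_set: "frob_norm R A = L2_set (\<lambda>r. norm (A r)) {1..R}"
  unfolding frob_norm_def frob_inner_eq_sum_inner L2_set_def by (simp add: power2_norm_eq_inner)

lemma frob_norm_nonneg: "frob_norm R A \<ge> 0"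
  by (simp add: frob_norm_eq_L2_set)

lemma frob_norm_sq: "(frob_norm R A)\<^sup>2 = (\<Sum>r=1..R. (norm (A r))\<^sup>2)"
  unfolding frob_norm_eq_L2_set L2_set_def by (simp add: sum_nonneg)

lemma frob_inner_outer:
  "frob_inner R A (outer R v z) = (\<Sum>r=1..R. v r * (A r \<bullet> z))"
proof -
  have "A r \<bullet> outer R v z r = v r * (A r \<bullet> z)" if "r \<in> {1..R}" for r
    using that unfolding outer_def
    by (simp add: inner_vec_def sum_distrib_left mult.left_commute)
  then show ?thesis unfolding frob_inner_eq_sum_inner by simp
qed

lemma frob_inner_diff_left:
  "frob_inner R (\<lambda>r. A r - B r) C = frob_inner R A C - frob_inner R B C"
  unfolding frob_inner_eq_sum_inner by (simp add: inner_diff_left sum_subtractf)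

text \<open>
  The difference of the two sides is \<open>2 \<parallel>A - B\<parallel>\<^sup>2\<close>. This is what linearises the concave
  quadratic term of the objective.
\<close>

lemma frob_complete_square:
  "- 2 * (frob_norm R B)\<^sup>2 \<le> 2 * (frob_norm R A)\<^sup>2 - 4 * frob_inner R A B"
proof -
  have "0 \<le> (\<Sum>r=1..R. (norm (A r - B r))\<^sup>2)" by (intro sum_nonneg) simp
  also have "\<dots> = (frob_norm R A)\<^sup>2 + (frob_norm R B)\<^sup>2 - 2 * frob_inner R A B"
    unfolding frob_norm_sq frob_inner_eq_sum_inner
    by (simp add: power2_norm_eq_inner inner_diff_left inner_diff_right inner_commute
        sum.distrib sum_subtractf sum_distrib_left algebra_simps)
  finally show ?thesis by simp
qed

lemma frob_inner_self: "frob_inner R A A = (frob_norm R A)\<^sup>2"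
  unfolding frob_norm_sq frob_inner_eq_sum_inner by (simp add: power2_norm_eq_inner)

lemma abs_frob_inner_outer_le:
  "\<bar>frob_inner R A (outer R v z)\<bar> \<le> L2_set v {1..R} * frob_norm R A * norm z"
proof -
  have "\<bar>frob_inner R A (outer R v z)\<bar> \<le> (\<Sum>r=1..R. \<bar>v r\<bar> * \<bar>norm (A r)\<bar> * norm z)"
    unfolding frob_inner_outer
    by (rule order.trans[OF sum_abs], rule sum_mono)
       (simp add: abs_mult mult.assoc mult_left_mono Cauchy_Schwarz_ineq2)
  also have "\<dots> \<le> L2_set v {1..R} * L2_set (\<lambda>r. norm (A r)) {1..R} * norm z"
    unfolding sum_distrib_right[symmetric] by (intro mult_right_mono L2_set_mult_ineq) simp
  finally show ?thesis by (simp add: frob_norm_eq_L2_set)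
qed

text \<open>
  The function type carries the product topology, so Tychonoff's theorem applies once the
  components outside of \<open>{1..R}\<close> are pinned to the single value that extensionality allows.
\<close>

lemma compact_frob_ball:
  "compact {A :: nat \<Rightarrow> real ^ 'd. A \<in> matrices R \<and> frob_norm R A \<le> C}"
proof -
  let ?S = "\<lambda>r. if r \<in> {1..R} then cball (0 :: real ^ 'd) C else {undefined}"
  have "compactin (product_topology (\<lambda>_. euclidean) UNIV) (PiE UNIV ?S)"
    unfolding compactin_PiE by (auto simp: compactin_euclidean_iff)
  then have "compact (PiE UNIV ?S)"
    unfolding euclidean_product_topology compactin_euclidean_iff .
  moreover have "closed {A :: nat \<Rightarrow> real ^ 'd. frob_norm R A \<le> C}"
    unfolding frob_norm_eq_L2_set L2_set_def
    by (intro closed_Collect_le continuous_intros continuous_on_product_coordinates)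
  ultimately have "compact (PiE UNIV ?S \<inter> {A. frob_norm R A \<le> C})"
    by (rule compact_Int_closed)
  also have "PiE UNIV ?S \<inter> {A. frob_norm R A \<le> C} = {A. A \<in> matrices R \<and> frob_norm R A \<le> C}"
    (is "?L = ?R")
  proof (intro equalityI subsetI)
    fix A assume A: "A \<in> ?L"
    then have "A r = undefined" if "r \<notin> {1..R}" for r
      using that by (auto simp: PiE_def Pi_def dest!: spec[of _ r])
    with A show "A \<in> ?R" by (auto simp: matrices_def PiE_def extensional_def)
  next
    fix A assume A: "A \<in> ?R"
    have "norm (A r) \<le> C" if "r \<in> {1..R}" for r
      using member_le_L2_set[OF _ that, of "\<lambda>r. norm (A r)"] A
      by (simp add: frob_norm_eq_L2_set)
    moreover have "A r = undefined" if "r \<notin> {1..R}" for r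
      using that A by (auto simp: matrices_def PiE_def extensional_def)
    ultimately show "A \<in> ?L" using A by (auto simp: PiE_def)
  qed
  finally show ?thesis .
qed

lemma continuous_on_frob_norm_diff:
  "continuous_on UNIV (\<lambda>A :: nat \<Rightarrow> real ^ 'd. frob_norm R (\<lambda>r. A r - B r))"
  unfolding frob_norm_eq_L2_set L2_set_def
  by (intro continuous_intros continuous_on_product_coordinates)

section \<open>Infima, couplings and divergence\<close>

lemma INF_ereal_add_const:
  fixes f :: "'p \<Rightarrow> ereal"
  shows "(INF p\<in>C. ereal c + f p) = ereal c + (INF p\<in>C. f p)"
proof (rule antisym)
  have "(INF p\<in>C. ereal c + f p) - ereal c \<le> (INF p\<in>C. f p)"
  proof (rule INF_greatest)
    fix p assume "p \<in> C"
    then have "(INF p\<in>C. ereal c + f p) \<le> f p + ereal c"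
      by (metis INF_lower add.commute)
    then show "(INF p\<in>C. ereal c + f p) - ereal c \<le> f p"
      by (simp add: ereal_minus_le)
  qed
  then show "(INF p\<in>C. ereal c + f p) \<le> ereal c + (INF p\<in>C. f p)"
    by (simp add: ereal_minus_le add.commute)
  show "ereal c + (INF p\<in>C. f p) \<le> (INF p\<in>C. ereal c + f p)"
    by (intro INF_greatest add_left_mono INF_lower)
qed

text \<open>
  Coordinates can be optimised separately: choose a point in each of them whose value exceeds the
  infimum by less than the share \<open>\<delta>\<close> of the permitted error.
\<close>

lemma INF_PiE_sum:
  fixes g :: "'i \<Rightarrow> 'p \<Rightarrow> ereal"
  assumes fin: "finite I" and real: "\<And>i. i \<in> I \<Longrightarrow> \<bar>INF p\<in>C i. g i p\<bar> \<noteq> \<infinity>"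
  shows "(INF \<pi>\<in>PiE I C. \<Sum>i\<in>I. g i (\<pi> i)) = (\<Sum>i\<in>I. INF p\<in>C i. g i p)"
proof (rule antisym)
  show "(\<Sum>i\<in>I. INF p\<in>C i. g i p) \<le> (INF \<pi>\<in>PiE I C. \<Sum>i\<in>I. g i (\<pi> i))"
    by (intro INF_greatest sum_mono INF_lower) (auto simp: PiE_def)
  show "(INF \<pi>\<in>PiE I C. \<Sum>i\<in>I. g i (\<pi> i)) \<le> (\<Sum>i\<in>I. INF p\<in>C i. g i p)"
  proof (rule ereal_le_epsilon2)
    fix e :: real assume e: "0 < e"
    define \<delta> where "\<delta> = e / (real (card I) + 1)"
    have \<delta>: "0 < \<delta>" "real (card I) * \<delta> \<le> e"
      using e by (auto simp: \<delta>_def field_simps)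
    have "\<exists>p\<in>C i. g i p < (INF p\<in>C i. g i p) + ereal \<delta>" if "i \<in> I" for i
    proof -
      have "(INF p\<in>C i. g i p) < (INF p\<in>C i. g i p) + ereal \<delta>"
        using real[OF that] \<delta>(1) by (cases "INF p\<in>C i. g i p") auto
      then show ?thesis by (simp add: INF_less_iff)
    qed
    then obtain p where p: "\<And>i. i \<in> I \<Longrightarrow> p i \<in> C i"
        "\<And>i. i \<in> I \<Longrightarrow> g i (p i) < (INF p\<in>C i. g i p) + ereal \<delta>"
      by metis
    have "(INF \<pi>\<in>PiE I C. \<Sum>i\<in>I. g i (\<pi> i)) \<le> (\<Sum>i\<in>I. g i (restrict p I i))"
      by (rule INF_lower) (use p(1) in auto)
    also have "\<dots> \<le> (\<Sum>i\<in>I. (INF p\<in>C i. g i p) + ereal \<delta>)"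
      by (rule sum_mono) (use p(2) in \<open>auto intro: less_imp_le\<close>)
    also have "\<dots> = (\<Sum>i\<in>I. INF p\<in>C i. g i p) + ereal (real (card I) * \<delta>)"
      by (simp add: sum.distrib)
    also have "\<dots> \<le> (\<Sum>i\<in>I. INF p\<in>C i. g i p) + ereal e"
      using \<delta>(2) by (intro add_left_mono) simp
    finally show "(INF \<pi>\<in>PiE I C. \<Sum>i\<in>I. g i (\<pi> i)) \<le> (\<Sum>i\<in>I. INF p\<in>C i. g i p) + ereal e" .
  qed
qed

text \<open>
  When the divergence is finite, \<open>P\<close> has a real density with respect to \<open>Q\<close>, and Gibbs'
  inequality for densities applies.
\<close>

lemma D_KL_nonneg:
  assumes "prob_space P" "prob_space Q" "sets P = sets Q"
  shows "0 \<le> D_KL P Q"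
proof (cases "absolutely_continuous Q P \<and> integrable P (entropy_density (exp 1) Q P)")
  case True
  interpret P: prob_space P by fact
  interpret Q: prob_space Q by fact
  interpret information_space Q "exp 1" by unfold_locales simp
  note ac = True[THEN conjunct1] and int = True[THEN conjunct2]
  have fin: "finite_measure P" by unfold_locales
  obtain D where D: "D \<in> borel_measurable Q" "AE x in Q. RN_deriv Q P x = ennreal (D x)"
      "AE x in P. 0 < D x" "\<And>x. 0 \<le> D x"
    using Q.real_RN_deriv[OF fin ac assms(3)] by metis
  have "P = density Q (RN_deriv Q P)"
    using ac assms(3) by (rule Q.density_RN_deriv[symmetric])
  also have "\<dots> = density Q D"
    using D by (auto intro!: density_cong)
  finally have P: "P = density Q D" .
  from absolutely_continuous_AE[OF assms(3) ac D(2)] D ac assms(3) measurable_entropy_density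
  have "integrable P (\<lambda>x. log (exp 1) (D x))"
    by (intro integrable_cong_AE[THEN iffD2, OF _ _ _ int])
       (auto simp: P entropy_density_def)
  then have "integrable Q (\<lambda>x. D x * log (exp 1) (D x))"
    using D by (subst integrable_real_density[symmetric]) (auto simp: P[symmetric] comp_def)
  then have "0 \<le> KL_divergence (exp 1) Q (density Q D)"
    using D P assms(1) by (intro KL_nonneg) auto
  then show ?thesis using True P by (simp add: D_KL_def)
qed (auto simp: D_KL_def)

lemma D_KL_same:
  assumes "prob_space Q"
  shows "D_KL Q Q = 0"
proof -
  interpret Q: prob_space Q by fact
  have "AE x in Q. 1 = RN_deriv Q Q x"
    by (rule Q.RN_deriv_unique) (auto simp: density_1)
  then have "AE x in Q. entropy_density (exp 1) Q Q x = 0"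
    by eventually_elim (simp add: entropy_density_def)
  then have "integrable Q (entropy_density (exp 1) Q Q) \<longleftrightarrow> integrable Q (\<lambda>_. 0 :: real)"
    by (intro integrable_cong_AE) auto
  then show ?thesis
    by (simp add: D_KL_def absolutely_continuous_def Q.KL_same_eq_0 zero_ereal_def)
qed

text \<open>
  The product coupling shows that couplings exist; having divergence 0 it also keeps the infimum
  in each transport problem below \<open>\<infinity>\<close>.
\<close>

lemma product_measure_coupling:
  assumes "prob_space \<mu>" "prob_space \<nu>"
  shows "\<mu> \<Otimes>\<^sub>M \<nu> \<in> couplings \<mu> \<nu>"
proof -
  interpret \<mu>: prob_space \<mu> by fact
  interpret \<nu>: prob_space \<nu> by fact
  interpret pair_prob_space \<mu> \<nu> ..
  have "distr (\<mu> \<Otimes>\<^sub>M \<nu>) \<nu> snd = \<nu>"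
  proof -
    have "distr (\<mu> \<Otimes>\<^sub>M \<nu>) \<nu> snd = distr (\<nu> \<Otimes>\<^sub>M \<mu>) \<nu> (snd \<circ> (\<lambda>(x, y). (y, x)))"
      by (subst distr_pair_swap) (simp add: distr_distr)
    also have "snd \<circ> (\<lambda>(x, y). (y, x)) = (fst :: 'b \<times> 'a \<Rightarrow> 'b)" by auto
    finally show ?thesis by (simp add: \<mu>.distr_pair_fst)
  qed
  then show ?thesis
    by (auto simp: couplings_def \<nu>.distr_pair_fst intro: prob_space_axioms)
qed

context
  fixes \<mu> :: "'a measure" and \<nu> :: "'b measure" and \<pi>
  assumes \<pi>: "\<pi> \<in> couplings \<mu> \<nu>"
begin

lemma coupling_prob: "prob_space \<pi>"
  and coupling_sets: "sets \<pi> = sets (\<mu> \<Otimes>\<^sub>M \<nu>)"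
  using \<pi> by (auto simp: couplings_def)

lemma coupling_space: "space \<pi> = space \<mu> \<times> space \<nu>"
  using sets_eq_imp_space_eq[OF coupling_sets] by (simp add: space_pair_measure)

lemma coupling_measurable_fst: "fst \<in> measurable \<pi> \<mu>"
  and coupling_measurable_snd: "snd \<in> measurable \<pi> \<nu>"
  by (simp_all add: measurable_cong_sets[OF coupling_sets refl])

lemma integral_coupling_fst:
  fixes f :: "'a \<Rightarrow> real"
  assumes "f \<in> borel_measurable \<mu>"
  shows "(\<integral>p. f (fst p) \<partial>\<pi>) = (\<integral>x. f x \<partial>\<mu>)"
  using integral_distr[OF coupling_measurable_fst assms] \<pi> by (simp add: couplings_def)

lemma integral_coupling_snd:
  fixes f :: "'b \<Rightarrow> real"
  assumes "f \<in> borel_measurable \<nu>"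
  shows "(\<integral>p. f (snd p) \<partial>\<pi>) = (\<integral>z. f z \<partial>\<nu>)"
  using integral_distr[OF coupling_measurable_snd assms] \<pi> by (simp add: couplings_def)

lemma integrable_coupling_snd:
  fixes f :: "'b \<Rightarrow> real"
  assumes "integrable \<nu> f"
  shows "integrable \<pi> (\<lambda>p. f (snd p))"
  using integrable_distr_eq[OF coupling_measurable_snd borel_measurable_integrable[OF assms]]
    \<pi> assms by (simp add: couplings_def)

end

section \<open>The objectives in terms of moments of the couplings\<close>

text \<open>
  What the argument extracts from the assumptions on the kernel and on \<open>\<nu>\<close>: the features are
  measurable and bounded by \<open>\<kappa>\<close> in Euclidean norm, and \<open>\<nu>\<close> has a second moment and a first moment
  of at most \<open>b\<close>.
\<close>

locale bounded_features =
  fixes M R :: nat and \<epsilon> \<kappa> b :: real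
    and \<phi> :: "nat \<Rightarrow> nat \<times> 'a \<Rightarrow> real" and \<mu> :: "nat \<Rightarrow> 'a measure"
    and \<nu> :: "(real ^ 'd) measure"
  assumes eps_pos: "\<epsilon> > 0" and kappa_nonneg: "\<kappa> \<ge> 0"
    and prob_mu: "\<And>i. i \<in> {1..M} \<Longrightarrow> prob_space (\<mu> i)"
    and prob_nu: "prob_space \<nu>"
    and nu_borel: "(\<lambda>z. z) \<in> borel_measurable \<nu>"
    and feature_measurable: "\<And>i r. i \<in> {1..M} \<Longrightarrow> r \<in> {1..R} \<Longrightarrow>
      (\<lambda>x. \<phi> r (i, x)) \<in> borel_measurable (\<mu> i)"
    and feature_bound: "\<And>i x. i \<in> {1..M} \<Longrightarrow> x \<in> space (\<mu> i) \<Longrightarrow>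
      L2_set (\<lambda>r. \<phi> r (i, x)) {1..R} \<le> \<kappa>"
    and norm_integrable: "integrable \<nu> norm"
    and norm_sq_integrable: "integrable \<nu> (\<lambda>z. (norm z)\<^sup>2)"
    and first_moment: "(\<integral>z. norm z \<partial>\<nu>) \<le> b"
begin

definition mass_moment :: "nat \<Rightarrow> ('a \<times> (real ^ 'd)) measure \<Rightarrow> nat \<Rightarrow> real" where
  "mass_moment i \<pi> r = (\<integral>p. \<phi> r (i, fst p) \<partial>\<pi>)"

definition cross_moment :: "nat \<Rightarrow> ('a \<times> (real ^ 'd)) measure \<Rightarrow> nat \<Rightarrow> real ^ 'd" where
  "cross_moment i \<pi> r = (\<integral>p. \<phi> r (i, fst p) *\<^sub>R snd p \<partial>\<pi>)"

definition square_moment :: "nat \<Rightarrow> ('a \<times> (real ^ 'd)) measure \<Rightarrow> nat \<Rightarrow> real" where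
  "square_moment i \<pi> r = (\<integral>p. \<phi> r (i, fst p) * (norm (snd p))\<^sup>2 \<partial>\<pi>)"

lemma abs_feature_le:
  assumes "i \<in> {1..M}" "r \<in> {1..R}" "x \<in> space (\<mu> i)"
  shows "\<bar>\<phi> r (i, x)\<bar> \<le> \<kappa>"
  using member_le_L2_set[of "{1..R}" r "\<lambda>r. \<bar>\<phi> r (i, x)\<bar>"] feature_bound[OF assms(1,3)] assms(2)
  by (simp add: L2_set_def)

context
  fixes i \<pi>
  assumes i: "i \<in> {1..M}" and \<pi>: "\<pi> \<in> couplings (\<mu> i) \<nu>"
begin

lemma feature_fst_measurable:
  "r \<in> {1..R} \<Longrightarrow> (\<lambda>p. \<phi> r (i, fst p)) \<in> borel_measurable \<pi>"
  using measurable_compose[OF coupling_measurable_fst[OF \<pi>] feature_measurable[OF i]] .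

lemma snd_borel_measurable: "snd \<in> borel_measurable \<pi>"
  using measurable_compose[OF coupling_measurable_snd[OF \<pi>] nu_borel] by simp

lemma has_mass_moment:
  assumes r: "r \<in> {1..R}"
  shows "has_bochner_integral \<pi> (\<lambda>p. \<phi> r (i, fst p)) (mass_moment i \<pi> r)"
proof -
  interpret prob_space \<pi> by (rule coupling_prob[OF \<pi>])
  have "integrable \<pi> (\<lambda>p. \<phi> r (i, fst p))"
    by (rule integrable_const_bound[where B = \<kappa>])
       (use abs_feature_le[OF i r] feature_fst_measurable[OF r] in
         \<open>auto intro!: AE_I2 simp: coupling_space[OF \<pi>]\<close>)
  then show ?thesis by (simp add: has_bochner_integral_iff mass_moment_def)
qed

lemma has_cross_moment:
  assumes r: "r \<in> {1..R}"
  shows "has_bochner_integral \<pi> (\<lambda>p. \<phi> r (i, fst p) *\<^sub>R snd p) (cross_moment i \<pi> r)"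
proof -
  have "integrable \<pi> (\<lambda>p. \<phi> r (i, fst p) *\<^sub>R snd p)"
  proof (rule Bochner_Integration.integrable_bound)
    show "integrable \<pi> (\<lambda>p. \<kappa> * norm (snd p))"
      using integrable_coupling_snd[OF \<pi> norm_integrable] by simp
    show "AE p in \<pi>. norm (\<phi> r (i, fst p) *\<^sub>R snd p) \<le> norm (\<kappa> * norm (snd p))"
      using abs_feature_le[OF i r] kappa_nonneg
      by (auto intro!: AE_I2 mult_right_mono simp: coupling_space[OF \<pi>] abs_mult)
  qed (intro borel_measurable_scaleR feature_fst_measurable r snd_borel_measurable)
  then show ?thesis by (simp add: has_bochner_integral_iff cross_moment_def)
qed

lemma has_square_moment:
  assumes r: "r \<in> {1..R}"
  shows "has_bochner_integral \<pi> (\<lambda>p. \<phi> r (i, fst p) * (norm (snd p))\<^sup>2) (square_moment i \<pi> r)"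
    and abs_square_moment_le: "\<bar>square_moment i \<pi> r\<bar> \<le> \<kappa> * (\<integral>z. (norm z)\<^sup>2 \<partial>\<nu>)"
proof -
  note [measurable] = feature_fst_measurable[OF r] snd_borel_measurable
  have int: "integrable \<pi> (\<lambda>p. \<kappa> * (norm (snd p))\<^sup>2)"
    using integrable_coupling_snd[OF \<pi> norm_sq_integrable] by simp
  have le: "\<bar>\<phi> r (i, fst p) * (norm (snd p))\<^sup>2\<bar> \<le> \<kappa> * (norm (snd p))\<^sup>2" if "p \<in> space \<pi>" for p
    using abs_feature_le[OF i r, of "fst p"] that
    by (auto intro!: mult_right_mono simp: coupling_space[OF \<pi>] abs_mult)
  have int': "integrable \<pi> (\<lambda>p. \<phi> r (i, fst p) * (norm (snd p))\<^sup>2)"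
  proof (rule Bochner_Integration.integrable_bound[OF int])
    show "AE p in \<pi>. norm (\<phi> r (i, fst p) * (norm (snd p))\<^sup>2) \<le> norm (\<kappa> * (norm (snd p))\<^sup>2)"
      using le kappa_nonneg by (auto intro!: AE_I2)
  qed measurable
  then show "has_bochner_integral \<pi> (\<lambda>p. \<phi> r (i, fst p) * (norm (snd p))\<^sup>2) (square_moment i \<pi> r)"
    by (simp add: has_bochner_integral_iff square_moment_def)
  have "\<bar>square_moment i \<pi> r\<bar> \<le> (\<integral>p. \<bar>\<phi> r (i, fst p) * (norm (snd p))\<^sup>2\<bar> \<partial>\<pi>)"
    unfolding square_moment_def by (rule integral_abs_bound)
  also have "\<dots> \<le> (\<integral>p. \<kappa> * (norm (snd p))\<^sup>2 \<partial>\<pi>)"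
    by (rule integral_mono[OF _ int]) (use int' le in auto)
  also have "\<dots> = \<kappa> * (\<integral>z. (norm z)\<^sup>2 \<partial>\<nu>)"
    using integral_coupling_snd[OF \<pi>, of "\<lambda>z. (norm z)\<^sup>2"] norm_sq_integrable by simp
  finally show "\<bar>square_moment i \<pi> r\<bar> \<le> \<kappa> * (\<integral>z. (norm z)\<^sup>2 \<partial>\<nu>)" .
qed

lemma has_frob_cross_moment:
  "has_bochner_integral \<pi> (\<lambda>p. frob_inner R A (outer R (\<lambda>r. \<phi> r (i, fst p)) (snd p)))
     (frob_inner R A (cross_moment i \<pi>))"
proof -
  have "has_bochner_integral \<pi> (\<lambda>p. \<Sum>r=1..R. A r \<bullet> (\<phi> r (i, fst p) *\<^sub>R snd p))
      (\<Sum>r=1..R. A r \<bullet> cross_moment i \<pi> r)"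
    by (intro has_bochner_integral_sum has_bochner_integral_inner_right has_cross_moment)
  then show ?thesis unfolding frob_inner_outer by (simp add: frob_inner_eq_sum_inner)
qed

text \<open>
  Every coupling has the same second marginal, so the bound does not depend on \<open>\<pi>\<close>. It serves
  twice: it locates the optimal matrix, and it makes the lifted problems Lipschitz in \<open>A\<close>.
\<close>

lemma abs_frob_cross_moment_le:
  "\<bar>frob_inner R A (cross_moment i \<pi>)\<bar> \<le> \<kappa> * b * frob_norm R A"
proof -
  let ?f = "\<lambda>p. frob_inner R A (outer R (\<lambda>r. \<phi> r (i, fst p)) (snd p))"
  have int: "integrable \<pi> ?f" "frob_inner R A (cross_moment i \<pi>) = integral\<^sup>L \<pi> ?f"
    using has_frob_cross_moment[of A] by (auto simp: has_bochner_integral_iff)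
  have "\<bar>integral\<^sup>L \<pi> ?f\<bar> \<le> (\<integral>p. \<bar>?f p\<bar> \<partial>\<pi>)" by (rule integral_abs_bound)
  also have "\<dots> \<le> (\<integral>p. \<kappa> * frob_norm R A * norm (snd p) \<partial>\<pi>)"
  proof (rule integral_mono)
    fix p assume "p \<in> space \<pi>"
    then have "L2_set (\<lambda>r. \<phi> r (i, fst p)) {1..R} \<le> \<kappa>"
      by (intro feature_bound i) (auto simp: coupling_space[OF \<pi>])
    then have "L2_set (\<lambda>r. \<phi> r (i, fst p)) {1..R} * frob_norm R A * norm (snd p)
        \<le> \<kappa> * frob_norm R A * norm (snd p)"
      by (intro mult_right_mono frob_norm_nonneg) auto
    then show "\<bar>?f p\<bar> \<le> \<kappa> * frob_norm R A * norm (snd p)"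
      using abs_frob_inner_outer_le order.trans by blast
  qed (use int(1) integrable_coupling_snd[OF \<pi> norm_integrable] in auto)
  also have "\<dots> = \<kappa> * frob_norm R A * (\<integral>z. norm z \<partial>\<nu>)"
    using integral_coupling_snd[OF \<pi>, of norm] norm_integrable by simp
  also have "\<dots> \<le> \<kappa> * frob_norm R A * b"
    using first_moment kappa_nonneg by (intro mult_left_mono) (auto simp: frob_norm_nonneg)
  finally show ?thesis using int(2) by (simp add: mult_ac)
qed

lemma integral_lifted_cost:
  "(\<integral>(x, z). lifted_cost R \<phi> A m i x z \<partial>\<pi>)
     = 2 * (\<Sum>r=1..R. m r * square_moment i \<pi> r) - 4 * frob_inner R A (cross_moment i \<pi>)"
proof -
  have "has_bochner_integral \<pi>
      (\<lambda>p. 2 * (\<Sum>r=1..R. m r * (\<phi> r (i, fst p) * (norm (snd p))\<^sup>2))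
        - 4 * frob_inner R A (outer R (\<lambda>r. \<phi> r (i, fst p)) (snd p)))
      (2 * (\<Sum>r=1..R. m r * square_moment i \<pi> r) - 4 * frob_inner R A (cross_moment i \<pi>))"
    by (intro has_bochner_integral_diff has_bochner_integral_mult_right has_bochner_integral_sum
        has_square_moment has_frob_cross_moment)
  moreover have "(\<lambda>(x, z). lifted_cost R \<phi> A m i x z)
      = (\<lambda>p. 2 * (\<Sum>r=1..R. m r * (\<phi> r (i, fst p) * (norm (snd p))\<^sup>2))
        - 4 * frob_inner R A (outer R (\<lambda>r. \<phi> r (i, fst p)) (snd p)))"
    by (auto simp: lifted_cost_def sum_distrib_left sum_distrib_right mult_ac intro!: sum.cong)
  ultimately show ?thesis by (simp add: has_bochner_integral_iff)
qed

end

text \<open>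
  With \<open>(x', z')\<close> fixed, the inner integrand is a combination of the three integrands whose
  integrals are the moments of \<open>\<pi>\<close>; the result is such a combination in \<open>(x', z')\<close>.
\<close>

lemma integral_pair_cost:
  assumes i: "i \<in> {1..M}" "\<pi> \<in> couplings (\<mu> i) \<nu>" and j: "j \<in> {1..M}" "\<pi>' \<in> couplings (\<mu> j) \<nu>"
  shows "(\<integral>(x', z'). (\<integral>(x, z). (\<Sum>r=1..R. \<phi> r (i, x) * \<phi> r (j, x')) * (norm (z - z'))\<^sup>2 \<partial>\<pi>) \<partial>\<pi>')
    = (\<Sum>r=1..R. mass_moment j \<pi>' r * square_moment i \<pi> r
        + mass_moment i \<pi> r * square_moment j \<pi>' r
        - 2 * (cross_moment i \<pi> r \<bullet> cross_moment j \<pi>' r))"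
proof -
  have inner: "(\<integral>(x, z). (\<Sum>r=1..R. \<phi> r (i, x) * \<phi> r (j, x')) * (norm (z - z'))\<^sup>2 \<partial>\<pi>)
    = (\<Sum>r=1..R. square_moment i \<pi> r * \<phi> r (j, x') + mass_moment i \<pi> r * (\<phi> r (j, x') * (norm z')\<^sup>2)
        - 2 * (cross_moment i \<pi> r \<bullet> (\<phi> r (j, x') *\<^sub>R z')))" for x' z'
  proof -
    have "has_bochner_integral \<pi>
      (\<lambda>p. \<Sum>r=1..R. \<phi> r (j, x') * (\<phi> r (i, fst p) * (norm (snd p))\<^sup>2)
        + \<phi> r (j, x') * (norm z')\<^sup>2 * \<phi> r (i, fst p)
        - 2 * \<phi> r (j, x') * (z' \<bullet> (\<phi> r (i, fst p) *\<^sub>R snd p)))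
      (\<Sum>r=1..R. \<phi> r (j, x') * square_moment i \<pi> r
        + \<phi> r (j, x') * (norm z')\<^sup>2 * mass_moment i \<pi> r
        - 2 * \<phi> r (j, x') * (z' \<bullet> cross_moment i \<pi> r))"
      by (intro has_bochner_integral_sum has_bochner_integral_diff has_bochner_integral_add
          has_bochner_integral_mult_right has_bochner_integral_inner_right
          has_square_moment[OF i] has_mass_moment[OF i] has_cross_moment[OF i])
    moreover have "(\<lambda>(x, z). (\<Sum>r=1..R. \<phi> r (i, x) * \<phi> r (j, x')) * (norm (z - z'))\<^sup>2)
      = (\<lambda>p. \<Sum>r=1..R. \<phi> r (j, x') * (\<phi> r (i, fst p) * (norm (snd p))\<^sup>2)
        + \<phi> r (j, x') * (norm z')\<^sup>2 * \<phi> r (i, fst p)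
        - 2 * \<phi> r (j, x') * (z' \<bullet> (\<phi> r (i, fst p) *\<^sub>R snd p)))"
      unfolding sum_distrib_right power2_norm_eq_inner
      by (intro ext) (auto simp: inner_diff_left inner_diff_right inner_commute algebra_simps
          intro!: sum.cong)
    ultimately show ?thesis
      by (simp add: has_bochner_integral_iff inner_commute mult_ac)
  qed
  have "has_bochner_integral \<pi>'
      (\<lambda>p. \<Sum>r=1..R. square_moment i \<pi> r * \<phi> r (j, fst p)
        + mass_moment i \<pi> r * (\<phi> r (j, fst p) * (norm (snd p))\<^sup>2)
        - 2 * (cross_moment i \<pi> r \<bullet> (\<phi> r (j, fst p) *\<^sub>R snd p)))
      (\<Sum>r=1..R. square_moment i \<pi> r * mass_moment j \<pi>' r
        + mass_moment i \<pi> r * square_moment j \<pi>' r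
        - 2 * (cross_moment i \<pi> r \<bullet> cross_moment j \<pi>' r))"
    by (intro has_bochner_integral_sum has_bochner_integral_diff has_bochner_integral_add
        has_bochner_integral_mult_right has_bochner_integral_inner_right
        has_square_moment[OF j] has_mass_moment[OF j] has_cross_moment[OF j])
  then show ?thesis
    unfolding inner by (simp add: has_bochner_integral_iff case_prod_unfold mult_ac)
qed

abbreviation plans :: "(nat \<Rightarrow> ('a \<times> (real ^ 'd)) measure) set" where
  "plans \<equiv> (\<Pi>\<^sub>E i\<in>{1..M}. couplings (\<mu> i) \<nu>)"

text \<open>
  The matrix \<open>B\<close> that completes the square; the restriction makes it a member of \<open>matrices R\<close>.
\<close>

definition total_cross :: "(nat \<Rightarrow> ('a \<times> (real ^ 'd)) measure) \<Rightarrow> nat \<Rightarrow> real ^ 'd" where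
  "total_cross \<pi> = (\<lambda>r\<in>{1..R}. \<Sum>i=1..M. cross_moment i (\<pi> i) r)"

lemma frob_inner_total_cross:
  "frob_inner R A (total_cross \<pi>) = (\<Sum>i=1..M. frob_inner R A (cross_moment i (\<pi> i)))"
proof -
  have "frob_inner R A (total_cross \<pi>) = (\<Sum>r=1..R. \<Sum>i=1..M. A r \<bullet> cross_moment i (\<pi> i) r)"
    unfolding frob_inner_eq_sum_inner total_cross_def
    by (intro sum.cong) (auto simp: inner_sum_right)
  also have "\<dots> = (\<Sum>i=1..M. frob_inner R A (cross_moment i (\<pi> i)))"
    unfolding frob_inner_eq_sum_inner by (rule sum.swap)
  finally show ?thesis .
qed

text \<open>
  Summed over all pairs, the mass moments add up to the mean feature and the cross moments to the
  square of their total.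
\<close>

lemma quadratic_objective_eq:
  assumes \<pi>: "\<pi> \<in> plans"
  shows "(\<Sum>i=1..M. \<Sum>j=1..M.
      \<integral>(x', z'). (\<integral>(x, z). (\<Sum>r=1..R. \<phi> r (i, x) * \<phi> r (j, x')) * (norm (z - z'))\<^sup>2 \<partial>\<pi> i) \<partial>\<pi> j)
    = (\<Sum>i=1..M. 2 * (\<Sum>r=1..R. mean_feature M \<phi> \<mu> r * square_moment i (\<pi> i) r))
      - 2 * (frob_norm R (total_cross \<pi>))\<^sup>2"
proof -
  have \<pi>i: "\<pi> i \<in> couplings (\<mu> i) \<nu>" if "i \<in> {1..M}" for i using \<pi> that by auto
  let ?a = "\<lambda>i r. mass_moment i (\<pi> i) r" and ?s = "\<lambda>i r. square_moment i (\<pi> i) r"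
    and ?c = "\<lambda>i r. cross_moment i (\<pi> i) r" and ?m = "mean_feature M \<phi> \<mu>"
  have mean: "(\<Sum>i=1..M. ?a i r) = ?m r" if "r \<in> {1..R}" for r
    unfolding mean_feature_def mass_moment_def
    by (intro sum.cong refl integral_coupling_fst[OF \<pi>i] feature_measurable that)
  have "(\<Sum>i=1..M. \<Sum>j=1..M.
      \<integral>(x', z'). (\<integral>(x, z). (\<Sum>r=1..R. \<phi> r (i, x) * \<phi> r (j, x')) * (norm (z - z'))\<^sup>2 \<partial>\<pi> i) \<partial>\<pi> j)
    = (\<Sum>i=1..M. \<Sum>j=1..M. \<Sum>r=1..R. ?a j r * ?s i r + ?a i r * ?s j r - 2 * (?c i r \<bullet> ?c j r))"
    by (intro sum.cong refl integral_pair_cost \<pi>i)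
  also have "\<dots> = (\<Sum>r=1..R. \<Sum>i=1..M. \<Sum>j=1..M. ?a j r * ?s i r + ?a i r * ?s j r - 2 * (?c i r \<bullet> ?c j r))"
    by (simp only: sum.swap[of _ "{1..R}"])
  also have "\<dots> = (\<Sum>r=1..R. 2 * (?m r * (\<Sum>i=1..M. ?s i r)) - 2 * (norm (total_cross \<pi> r))\<^sup>2)"
  proof (rule sum.cong[OF refl])
    fix r assume r: "r \<in> {1..R}"
    have "(\<Sum>i=1..M. ?c i r) \<bullet> (\<Sum>i=1..M. ?c i r) = (\<Sum>i=1..M. \<Sum>j=1..M. ?c i r \<bullet> ?c j r)"
      unfolding inner_sum_left inner_sum_right by (rule sum.swap)
    then have "(\<Sum>i=1..M. \<Sum>j=1..M. ?a j r * ?s i r + ?a i r * ?s j r - 2 * (?c i r \<bullet> ?c j r))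
      = (\<Sum>i=1..M. ?a i r) * (\<Sum>i=1..M. ?s i r) + (\<Sum>i=1..M. ?a i r) * (\<Sum>i=1..M. ?s i r)
        - 2 * ((\<Sum>i=1..M. ?c i r) \<bullet> (\<Sum>i=1..M. ?c i r))"
      by (simp add: sum.distrib sum_subtractf sum_distrib_left[symmetric] sum_distrib_right[symmetric])
    then show "(\<Sum>i=1..M. \<Sum>j=1..M. ?a j r * ?s i r + ?a i r * ?s j r - 2 * (?c i r \<bullet> ?c j r))
      = 2 * (?m r * (\<Sum>i=1..M. ?s i r)) - 2 * (norm (total_cross \<pi> r))\<^sup>2"
      using r by (simp add: mean[OF r] total_cross_def power2_norm_eq_inner del: One_nat_def)
  qed
  also have "\<dots> = (\<Sum>r=1..R. \<Sum>i=1..M. 2 * (?m r * ?s i r)) - 2 * (frob_norm R (total_cross \<pi>))\<^sup>2"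
    unfolding frob_norm_sq by (simp add: sum_subtractf sum_distrib_left)
  also have "(\<Sum>r=1..R. \<Sum>i=1..M. 2 * (?m r * ?s i r)) = (\<Sum>i=1..M. 2 * (\<Sum>r=1..R. ?m r * ?s i r))"
    unfolding sum_distrib_left by (rule sum.swap)
  finally show ?thesis .
qed

section \<open>The lifted problems as functions of the matrix\<close>

definition plan_cost :: "(nat \<Rightarrow> real ^ 'd) \<Rightarrow> nat \<Rightarrow> ('a \<times> (real ^ 'd)) measure \<Rightarrow> ereal" where
  "plan_cost A i \<pi> = ereal (\<integral>(x, z). lifted_cost R \<phi> A (mean_feature M \<phi> \<mu>) i x z \<partial>\<pi>)
     + ereal \<epsilon> * D_KL \<pi> (\<mu> i \<Otimes>\<^sub>M \<nu>)"

abbreviation OT :: "(nat \<Rightarrow> real ^ 'd) \<Rightarrow> nat \<Rightarrow> ereal" where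
  "OT A i \<equiv> lifted_OT R \<epsilon> \<phi> A (mean_feature M \<phi> \<mu>) i (\<mu> i) \<nu>"

lemma OT_eq_INF_plan_cost: "OT A i = (INF \<pi>\<in>couplings (\<mu> i) \<nu>. plan_cost A i \<pi>)"
  by (simp add: lifted_OT_def plan_cost_def)

lemma D_KL_coupling_nonneg:
  assumes "i \<in> {1..M}" "\<pi> \<in> couplings (\<mu> i) \<nu>"
  shows "0 \<le> D_KL \<pi> (\<mu> i \<Otimes>\<^sub>M \<nu>)"
  using product_measure_coupling[OF prob_mu[OF assms(1)] prob_nu]
  by (intro D_KL_nonneg coupling_prob[OF assms(2)] coupling_sets[OF assms(2)] coupling_prob)

text \<open>
  The linear cost is bounded below over all couplings because its moments are controlled by the
  common second marginal, and the divergence is nonnegative.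
\<close>

lemma OT_finite:
  assumes i: "i \<in> {1..M}"
  shows "\<bar>OT A i\<bar> \<noteq> \<infinity>"
proof -
  let ?m = "mean_feature M \<phi> \<mu>" and ?P = "\<mu> i \<Otimes>\<^sub>M \<nu>"
  have P: "?P \<in> couplings (\<mu> i) \<nu>"
    by (rule product_measure_coupling[OF prob_mu[OF i] prob_nu])
  have "OT A i \<le> plan_cost A i ?P"
    unfolding OT_eq_INF_plan_cost by (rule INF_lower[OF P])
  also have "\<dots> < \<infinity>" by (simp add: plan_cost_def D_KL_same[OF coupling_prob[OF P]])
  finally have upper: "OT A i < \<infinity>" .
  \<comment> \<open>a lower bound for the linear cost, in terms of moments of \<open>\<nu>\<close>\<close>
  define L where "L = - (2 * (\<Sum>r=1..R. \<bar>?m r\<bar> * (\<kappa> * (\<integral>z. (norm z)\<^sup>2 \<partial>\<nu>))))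
    - 4 * (\<kappa> * b * frob_norm R A)"
  have "ereal L \<le> OT A i"
    unfolding OT_eq_INF_plan_cost
  proof (rule INF_greatest)
    fix \<pi> assume \<pi>: "\<pi> \<in> couplings (\<mu> i) \<nu>"
    have "\<bar>\<Sum>r=1..R. ?m r * square_moment i \<pi> r\<bar> \<le> (\<Sum>r=1..R. \<bar>?m r\<bar> * (\<kappa> * (\<integral>z. (norm z)\<^sup>2 \<partial>\<nu>)))"
      by (rule order.trans[OF sum_abs], rule sum_mono)
         (auto simp: abs_mult intro!: mult_left_mono abs_square_moment_le[OF i \<pi>])
    then have "L \<le> (\<integral>(x, z). lifted_cost R \<phi> A ?m i x z \<partial>\<pi>)"
      using abs_frob_cross_moment_le[OF i \<pi>, of A] unfolding integral_lifted_cost[OF i \<pi>] L_def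
      by linarith
    moreover have "0 \<le> ereal \<epsilon> * D_KL \<pi> ?P"
      using eps_pos D_KL_coupling_nonneg[OF i \<pi>] by simp
    ultimately show "ereal L \<le> plan_cost A i \<pi>"
      unfolding plan_cost_def using add_mono[of "ereal L" _ 0] by fastforce
  qed
  with upper show ?thesis by auto
qed

text \<open>
  Replacing \<open>B\<close> by \<open>A\<close> changes the cost of each coupling by at most the same amount, hence also
  the infimum.
\<close>

lemma OT_lipschitz:
  assumes i: "i \<in> {1..M}"
  shows "real_of_ereal (OT A i) \<le> real_of_ereal (OT B i) + 4 * \<kappa> * b * frob_norm R (\<lambda>r. A r - B r)"
proof -
  let ?m = "mean_feature M \<phi> \<mu>"
  define \<delta> where "\<delta> = 4 * \<kappa> * b * frob_norm R (\<lambda>r. A r - B r)"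
  have "OT A i - ereal \<delta> \<le> OT B i"
    unfolding OT_eq_INF_plan_cost[of B]
  proof (rule INF_greatest)
    fix \<pi> assume \<pi>: "\<pi> \<in> couplings (\<mu> i) \<nu>"
    have "(\<integral>(x, z). lifted_cost R \<phi> A ?m i x z \<partial>\<pi>) \<le> (\<integral>(x, z). lifted_cost R \<phi> B ?m i x z \<partial>\<pi>) + \<delta>"
      using abs_frob_cross_moment_le[OF i \<pi>, of "\<lambda>r. A r - B r"]
      unfolding integral_lifted_cost[OF i \<pi>] \<delta>_def frob_inner_diff_left by linarith
    then have "plan_cost A i \<pi> \<le> plan_cost B i \<pi> + ereal \<delta>"
      unfolding plan_cost_def by (cases "ereal \<epsilon> * D_KL \<pi> (\<mu> i \<Otimes>\<^sub>M \<nu>)") auto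
    moreover have "OT A i \<le> plan_cost A i \<pi>"
      unfolding OT_eq_INF_plan_cost by (rule INF_lower[OF \<pi>])
    ultimately have "OT A i \<le> plan_cost B i \<pi> + ereal \<delta>" by (rule order.trans[rotated])
    then show "OT A i - ereal \<delta> \<le> plan_cost B i \<pi>"
      by (simp add: ereal_minus_le)
  qed
  then show ?thesis
    using OT_finite[OF i, of A] OT_finite[OF i, of B] unfolding \<delta>_def[symmetric]
    by (cases "OT A i"; cases "OT B i") auto
qed

definition lifted_value :: "(nat \<Rightarrow> real ^ 'd) \<Rightarrow> real" where
  "lifted_value A = 2 * (frob_norm R A)\<^sup>2 + (\<Sum>i=1..M. real_of_ereal (OT A i))"

lemma lifted_objective_eq_value: "lifted_objective M R \<epsilon> \<phi> \<mu> \<nu> A = ereal (lifted_value A)"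
proof -
  have "(\<Sum>i=1..M. OT A i) = (\<Sum>i=1..M. ereal (real_of_ereal (OT A i)))"
    by (intro sum.cong) (auto simp: ereal_real' OT_finite)
  then show ?thesis unfolding lifted_objective_def lifted_value_def by simp
qed

lemma continuous_on_lifted_value: "continuous_on UNIV lifted_value"
proof -
  have OT: "continuous_on UNIV (\<lambda>A. real_of_ereal (OT A i))" if i: "i \<in> {1..M}" for i
    unfolding continuous_on_def
  proof (intro ballI)
    fix B :: "nat \<Rightarrow> real ^ 'd"
    let ?\<delta> = "\<lambda>A. 4 * \<kappa> * b * frob_norm R (\<lambda>r. A r - B r)"
    have sym: "frob_norm R (\<lambda>r. B r - A r) = frob_norm R (\<lambda>r. A r - B r)" for A
      by (simp add: frob_norm_eq_L2_set norm_minus_commute)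
    have "((\<lambda>A. frob_norm R (\<lambda>r. A r - B r)) \<longlongrightarrow> frob_norm R (\<lambda>r. B r - B r)) (at B within UNIV)"
      using continuous_on_frob_norm_diff unfolding continuous_on_def by blast
    then have "(?\<delta> \<longlongrightarrow> 4 * \<kappa> * b * frob_norm R (\<lambda>r. B r - B r)) (at B within UNIV)"
      by (intro tendsto_intros)
    then have "(?\<delta> \<longlongrightarrow> 0) (at B within UNIV)"
      by (simp add: frob_norm_eq_L2_set L2_set_def)
    moreover have "\<forall>\<^sub>F A in at B within UNIV.
        norm (real_of_ereal (OT A i) - real_of_ereal (OT B i)) \<le> ?\<delta> A"
      using OT_lipschitz[OF i, of _ B] OT_lipschitz[OF i, of B] sym
      by (intro always_eventually allI) (smt (verit) real_norm_def)
    ultimately have "((\<lambda>A. real_of_ereal (OT A i) - real_of_ereal (OT B i)) \<longlongrightarrow> 0) (at B within UNIV)"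
      by (rule Lim_null_comparison[rotated])
    then show "((\<lambda>A. real_of_ereal (OT A i)) \<longlongrightarrow> real_of_ereal (OT B i)) (at B within UNIV)"
      by (rule LIM_zero_cancel)
  qed
  show ?thesis
    unfolding lifted_value_def frob_norm_sq
    by (intro OT continuous_intros continuous_on_product_coordinates)
qed

section \<open>Exchanging the infima\<close>

definition joint_cost ::
    "(nat \<Rightarrow> real ^ 'd) \<Rightarrow> (nat \<Rightarrow> ('a \<times> (real ^ 'd)) measure) \<Rightarrow> ereal" where
  "joint_cost A \<pi> = ereal (2 * (frob_norm R A)\<^sup>2) + (\<Sum>i=1..M. plan_cost A i (\<pi> i))"

lemma lifted_objective_eq_INF:
  "lifted_objective M R \<epsilon> \<phi> \<mu> \<nu> A = (INF \<pi>\<in>plans. joint_cost A \<pi>)"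
proof -
  have fin: "\<bar>\<Sum>i=1..M. OT A i\<bar> \<noteq> \<infinity>" by (auto simp: sum_Inf OT_finite)
  have eq: "(\<Sum>i=1..M. OT A i) = (INF \<pi>\<in>plans. \<Sum>i=1..M. plan_cost A i (\<pi> i))"
    unfolding OT_eq_INF_plan_cost using OT_finite
    by (intro INF_PiE_sum[symmetric]) (auto simp: OT_eq_INF_plan_cost)
  show ?thesis
    unfolding lifted_objective_def joint_cost_def eq INF_ereal_add_const ..
qed

definition quadratic_cost :: "(nat \<Rightarrow> ('a \<times> (real ^ 'd)) measure) \<Rightarrow> ereal" where
  "quadratic_cost \<pi> =
     ereal (\<Sum>i=1..M. \<Sum>j=1..M.
       \<integral>(x', z'). (\<integral>(x, z). (\<Sum>r=1..R. \<phi> r (i, x) * \<phi> r (j, x')) * (norm (z - z'))\<^sup>2 \<partial>\<pi> i) \<partial>\<pi> j)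
     + ereal \<epsilon> * (\<Sum>i=1..M. D_KL (\<pi> i) (\<mu> i \<Otimes>\<^sub>M \<nu>))"

text \<open>
  The real summand on the right is \<open>2 \<parallel>A - B\<parallel>\<^sup>2\<close> for the total cross moment \<open>B\<close>, the excess of the
  joint cost over the original one.
\<close>

lemma joint_cost_eq:
  assumes \<pi>: "\<pi> \<in> plans"
  shows "joint_cost A \<pi> = ereal (2 * (frob_norm R A)\<^sup>2 - 4 * frob_inner R A (total_cross \<pi>)
       + 2 * (frob_norm R (total_cross \<pi>))\<^sup>2) + quadratic_cost \<pi>"
proof -
  have \<pi>i: "\<pi> i \<in> couplings (\<mu> i) \<nu>" if "i \<in> {1..M}" for i using \<pi> that by auto
  let ?s = "\<lambda>i. 2 * (\<Sum>r=1..R. mean_feature M \<phi> \<mu> r * square_moment i (\<pi> i) r)"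
  have KL: "ereal \<epsilon> * (\<Sum>i=1..M. D_KL (\<pi> i) (\<mu> i \<Otimes>\<^sub>M \<nu>)) = (\<Sum>i=1..M. ereal \<epsilon> * D_KL (\<pi> i) (\<mu> i \<Otimes>\<^sub>M \<nu>))"
    by (intro sum_ereal_right_distrib D_KL_coupling_nonneg \<pi>i)
  have "(\<Sum>i=1..M. plan_cost A i (\<pi> i))
    = (\<Sum>i=1..M. ereal (?s i - 4 * frob_inner R A (cross_moment i (\<pi> i)))
        + ereal \<epsilon> * D_KL (\<pi> i) (\<mu> i \<Otimes>\<^sub>M \<nu>))"
    unfolding plan_cost_def by (intro sum.cong refl) (simp add: integral_lifted_cost[OF _ \<pi>i])
  also have "\<dots> = ereal ((\<Sum>i=1..M. ?s i) - 4 * frob_inner R A (total_cross \<pi>))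
      + ereal \<epsilon> * (\<Sum>i=1..M. D_KL (\<pi> i) (\<mu> i \<Otimes>\<^sub>M \<nu>))"
    unfolding frob_inner_total_cross KL by (simp add: sum.distrib sum_subtractf sum_distrib_left)
  finally show ?thesis
    unfolding joint_cost_def quadratic_cost_def quadratic_objective_eq[OF \<pi>]
    by (simp add: add.assoc[symmetric])
qed

lemma total_cross_in_matrices: "total_cross \<pi> \<in> matrices R"
  by (simp add: total_cross_def matrices_def)

lemma joint_cost_ge:
  assumes "\<pi> \<in> plans"
  shows "quadratic_cost \<pi> \<le> joint_cost A \<pi>"
proof -
  have "0 \<le> ereal (2 * (frob_norm R A)\<^sup>2 - 4 * frob_inner R A (total_cross \<pi>)
       + 2 * (frob_norm R (total_cross \<pi>))\<^sup>2)"
    using frob_complete_square[of R "total_cross \<pi>" A] by simp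
  from add_right_mono[OF this, of "quadratic_cost \<pi>"] show ?thesis
    by (simp add: joint_cost_eq[OF assms])
qed

lemma joint_cost_total_cross:
  assumes "\<pi> \<in> plans"
  shows "joint_cost (total_cross \<pi>) \<pi> = quadratic_cost \<pi>"
  by (simp add: joint_cost_eq[OF assms] frob_inner_self flip: zero_ereal_def)

text \<open>
  Test the total cross moment against itself: \<open>\<parallel>B\<parallel>\<^sup>2 = \<langle>B, B\<rangle>\<close> is a sum of \<open>M\<close> pairings, each at
  most \<open>\<kappa> b \<parallel>B\<parallel>\<close>; then cancel \<open>\<parallel>B\<parallel>\<close>.
\<close>

lemma frob_norm_total_cross_le:
  assumes \<pi>: "\<pi> \<in> plans"
  shows "frob_norm R (total_cross \<pi>) \<le> M * \<kappa> * b"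
proof -
  let ?A = "total_cross \<pi>"
  have "(frob_norm R ?A)\<^sup>2 = (\<Sum>i=1..M. frob_inner R ?A (cross_moment i (\<pi> i)))"
    by (simp add: frob_inner_self[symmetric] frob_inner_total_cross)
  also have "\<dots> \<le> (\<Sum>i=1..M. \<kappa> * b * frob_norm R ?A)"
  proof (rule sum_mono)
    fix i assume i: "i \<in> {1..M}"
    then have "\<pi> i \<in> couplings (\<mu> i) \<nu>" using \<pi> by auto
    from abs_frob_cross_moment_le[OF i this, of ?A]
    show "frob_inner R ?A (cross_moment i (\<pi> i)) \<le> \<kappa> * b * frob_norm R ?A" by simp
  qed
  finally have "frob_norm R ?A * frob_norm R ?A \<le> (M * \<kappa> * b) * frob_norm R ?A"
    by (simp add: power2_eq_square mult_ac)
  moreover have "0 \<le> b"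
    by (rule order.trans[OF Bochner_Integration.integral_nonneg first_moment]) simp
  ultimately show ?thesis
    using frob_norm_nonneg[of R ?A] kappa_nonneg by (cases "frob_norm R ?A = 0") auto
qed

text \<open>
  Both sides are the infimum of the joint cost over \<open>A\<close> and \<open>\<pi>\<close>, taken over \<open>A\<close> first on the left
  and over \<open>\<pi>\<close> first on the right.
\<close>

theorem rank_objective_eq_INF_lifted:
  "rank_objective M R \<epsilon> \<phi> \<mu> \<nu> = (INF A\<in>matrices R. lifted_objective M R \<epsilon> \<phi> \<mu> \<nu> A)"
proof (rule antisym)
  have rank: "rank_objective M R \<epsilon> \<phi> \<mu> \<nu> = (INF \<pi>\<in>plans. quadratic_cost \<pi>)"
    by (simp add: rank_objective_def quadratic_cost_def)
  show "rank_objective M R \<epsilon> \<phi> \<mu> \<nu> \<le> (INF A\<in>matrices R. lifted_objective M R \<epsilon> \<phi> \<mu> \<nu> A)"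
    unfolding rank lifted_objective_eq_INF
    by (intro INF_greatest INF_mono) (blast intro: joint_cost_ge)
  show "(INF A\<in>matrices R. lifted_objective M R \<epsilon> \<phi> \<mu> \<nu> A) \<le> rank_objective M R \<epsilon> \<phi> \<mu> \<nu>"
    unfolding rank
  proof (rule INF_greatest)
    fix \<pi> assume \<pi>: "\<pi> \<in> plans"
    have "(INF A\<in>matrices R. lifted_objective M R \<epsilon> \<phi> \<mu> \<nu> A) \<le> lifted_objective M R \<epsilon> \<phi> \<mu> \<nu> (total_cross \<pi>)"
      by (rule INF_lower[OF total_cross_in_matrices])
    also have "\<dots> \<le> joint_cost (total_cross \<pi>) \<pi>"
      unfolding lifted_objective_eq_INF by (rule INF_lower[OF \<pi>])
    finally show "(INF A\<in>matrices R. lifted_objective M R \<epsilon> \<phi> \<mu> \<nu> A) \<le> quadratic_cost \<pi>"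
      by (simp add: joint_cost_total_cross[OF \<pi>])
  qed
qed

text \<open>
  A minimiser over the ball is a global one: every coupling family \<open>\<pi>\<close> is served at least as well
  by its own cross moment matrix, which lies in the ball, as by any other \<open>A\<close>.
\<close>

theorem lifted_minimiser_exists:
  "\<exists>A\<^sub>0\<in>matrices R. frob_norm R A\<^sub>0 \<le> M * \<kappa> * b \<and>
     lifted_objective M R \<epsilon> \<phi> \<mu> \<nu> A\<^sub>0 = (INF A\<in>matrices R. lifted_objective M R \<epsilon> \<phi> \<mu> \<nu> A)"
proof -
  let ?ball = "{A :: nat \<Rightarrow> real ^ 'd. A \<in> matrices R \<and> frob_norm R A \<le> M * \<kappa> * b}"
  have "restrict (\<lambda>i. \<mu> i \<Otimes>\<^sub>M \<nu>) {1..M} \<in> plans"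
    using product_measure_coupling[OF prob_mu prob_nu] by auto
  then have "?ball \<noteq> {}"
    using frob_norm_total_cross_le total_cross_in_matrices by blast
  then obtain A\<^sub>0 where A0: "A\<^sub>0 \<in> ?ball" and min: "\<And>A. A \<in> ?ball \<Longrightarrow> lifted_value A\<^sub>0 \<le> lifted_value A"
    using continuous_attains_inf[OF compact_frob_ball _
        continuous_on_subset[OF continuous_on_lifted_value subset_UNIV], of R "M * \<kappa> * b"]
    by blast
  have "lifted_objective M R \<epsilon> \<phi> \<mu> \<nu> A\<^sub>0 \<le> joint_cost A \<pi>" if \<pi>: "\<pi> \<in> plans" for A \<pi>
  proof -
    have "total_cross \<pi> \<in> ?ball"
      using frob_norm_total_cross_le[OF \<pi>] total_cross_in_matrices by blast
    from min[OF this]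
    have "lifted_objective M R \<epsilon> \<phi> \<mu> \<nu> A\<^sub>0 \<le> lifted_objective M R \<epsilon> \<phi> \<mu> \<nu> (total_cross \<pi>)"
      by (simp add: lifted_objective_eq_value)
    also have "\<dots> \<le> joint_cost (total_cross \<pi>) \<pi>"
      unfolding lifted_objective_eq_INF by (rule INF_lower[OF \<pi>])
    also have "\<dots> \<le> joint_cost A \<pi>"
      by (simp add: joint_cost_total_cross[OF \<pi>] joint_cost_ge[OF \<pi>])
    finally show ?thesis .
  qed
  then have "lifted_objective M R \<epsilon> \<phi> \<mu> \<nu> A\<^sub>0 \<le> lifted_objective M R \<epsilon> \<phi> \<mu> \<nu> A" for A
    unfolding lifted_objective_eq_INF[of A] by (rule INF_greatest)
  then have "lifted_objective M R \<epsilon> \<phi> \<mu> \<nu> A\<^sub>0 = (INF A\<in>matrices R. lifted_objective M R \<epsilon> \<phi> \<mu> \<nu> A)"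
    using A0 by (intro antisym INF_greatest INF_lower) auto
  then show ?thesis using A0 by blast
qed

end

section \<open>Consequences of the kernel and moment assumptions\<close>

text \<open>
  From \<open>1 + u \<le> exp u\<close> the fourth moment is at most \<open>2 s\<close>. For the first moment, Jensen's
  inequality for \<open>t\<^sup>4\<close> is applied through the tangent of \<open>t\<^sup>4\<close> at \<open>b = (2 s)\<^bsup>1/4\<^esup>\<close>.
\<close>

lemma sub_Weibull_moments:
  fixes \<nu> :: "'z :: euclidean_space measure"
  assumes prob: "prob_space \<nu>" and meas: "(\<lambda>z. z) \<in> borel_measurable \<nu>"
    and s: "s > 0" and weib: "four_sub_Weibull s \<nu>"
  shows "integrable \<nu> norm" "integrable \<nu> (\<lambda>z. (norm z)\<^sup>2)"
    "(\<integral>z. norm z \<partial>\<nu>) \<le> (2 * s) powr (1/4)"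
proof -
  interpret prob_space \<nu> by fact
  have norm_meas[measurable]: "norm \<in> borel_measurable \<nu>"
    using measurable_compose[OF meas borel_measurable_norm] .
  let ?g = "\<lambda>z :: 'z. norm z ^ 4 / (2 * s)"
  have nn: "(\<integral>\<^sup>+z. ennreal (exp (?g z)) \<partial>\<nu>) \<le> 2"
    using weib unfolding four_sub_Weibull_def .
  also have "(2 :: ennreal) < \<infinity>" by simp
  finally have exp_int: "integrable \<nu> (\<lambda>z. exp (?g z))"
    by (intro integrableI_nonneg) auto
  have "ennreal (\<integral>z. exp (?g z) \<partial>\<nu>) \<le> ennreal 2"
    using nn by (subst nn_integral_eq_integral[OF exp_int, symmetric]) auto
  then have exp_le: "(\<integral>z. exp (?g z) \<partial>\<nu>) \<le> 2" by (subst (asm) ennreal_le_iff) auto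
  have g_nonneg: "0 \<le> ?g z" for z using s by simp
  have g_int: "integrable \<nu> ?g"
  proof (rule Bochner_Integration.integrable_bound[OF exp_int])
    show "AE z in \<nu>. norm (?g z) \<le> norm (exp (?g z))"
    proof (rule AE_I2)
      fix z
      show "norm (?g z) \<le> norm (exp (?g z))"
        using exp_ge_add_one_self[of "?g z"] g_nonneg[of z]
        unfolding real_norm_def by linarith
    qed
  qed simp
  have "(\<integral>z. ?g z + 1 \<partial>\<nu>) \<le> (\<integral>z. exp (?g z) \<partial>\<nu>)"
    by (rule integral_mono) (use g_int exp_int exp_ge_add_one_self in \<open>auto simp: add.commute\<close>)
  also note exp_le
  finally have "(\<integral>z. ?g z \<partial>\<nu>) \<le> 1" using g_int by (simp add: prob_space)
  then have fourth: "(\<integral>z. norm z ^ 4 \<partial>\<nu>) \<le> 2 * s" using s by (simp add: field_simps)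
  have fourth_int: "integrable \<nu> (\<lambda>z. norm z ^ 4)"
    using integrable_mult_right[OF g_int, of "2 * s"] s by simp
  have one_int: "integrable \<nu> (\<lambda>z. 1 + norm z ^ 4)" using fourth_int by simp
  have sq_le: "t\<^sup>2 \<le> 1 / 4 + t ^ 4" for t :: real
    using zero_le_power2[of "t\<^sup>2 - 1/2"]
    by (simp add: power2_eq_square power4_eq_xxxx algebra_simps)
  have le: "t \<le> 1 + t ^ 4" for t :: real
  proof -
    have "t \<le> 1 / 4 + t\<^sup>2" using zero_le_power2[of "t - 1/2"]
      by (simp add: power2_eq_square algebra_simps)
    with sq_le[of t] show ?thesis by simp
  qed
  have sq_le': "t\<^sup>2 \<le> 1 + t ^ 4" for t :: real
    using sq_le[of t] by simp
  show "integrable \<nu> (\<lambda>z. (norm z)\<^sup>2)"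
    by (rule Bochner_Integration.integrable_bound[OF one_int]) (use sq_le' in \<open>auto intro!: AE_I2\<close>)
  show norm_int: "integrable \<nu> norm"
    by (rule Bochner_Integration.integrable_bound[OF one_int]) (use le in \<open>auto intro!: AE_I2\<close>)
  define b where "b = (2 * s) powr (1/4)"
  have b: "b > 0" "b ^ 4 = 2 * s"
    using s by (auto simp: b_def powr_power)
  have tangent: "4 * b ^ 3 * t \<le> t ^ 4 + 3 * b ^ 4" for t
  proof -
    have "0 \<le> (t - b)\<^sup>2 * ((t + b)\<^sup>2 + 2 * b\<^sup>2)" by simp
    also have "\<dots> = t ^ 4 + 3 * b ^ 4 - 4 * b ^ 3 * t" by algebra
    finally show ?thesis by simp
  qed
  have "4 * b ^ 3 * (\<integral>z. norm z \<partial>\<nu>) = (\<integral>z. 4 * b ^ 3 * norm z \<partial>\<nu>)" by simp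
  also have "\<dots> \<le> (\<integral>z. norm z ^ 4 + 3 * b ^ 4 \<partial>\<nu>)"
    by (rule integral_mono) (use norm_int fourth_int tangent in auto)
  also have "\<dots> \<le> 2 * s + 3 * b ^ 4"
    using fourth fourth_int by (simp add: prob_space)
  also have "\<dots> = 4 * b ^ 3 * b" using b(2) by (simp add: power_numeral_reduce)
  finally show "(\<integral>z. norm z \<partial>\<nu>) \<le> (2 * s) powr (1/4)"
    using b(1) by (simp add: b_def)
qed

text \<open>
  The sets whose slices are measurable already form a sigma algebra, so they are all the
  measurable sets of the average measure, and each inclusion \<open>x \<mapsto> (i, x)\<close> is measurable.
\<close>

lemma measurable_average_measure_slice:
  fixes f :: "nat \<times> 'a \<Rightarrow> real"
  assumes f: "f \<in> borel_measurable (average_measure M \<mu>)" and i: "i \<in> {1..M}"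
  shows "(\<lambda>x. f (i, x)) \<in> borel_measurable (\<mu> i)"
proof -
  let ?\<Omega> = "disjoint_union M (\<lambda>i. space (\<mu> i))"
  let ?\<S> = "{B. B \<subseteq> ?\<Omega> \<and> (\<forall>i\<in>{1..M}. Pair i -` B \<in> sets (\<mu> i))}"
  have space: "space (average_measure M \<mu>) = ?\<Omega>"
    unfolding average_measure_def by (rule space_measure_of) auto
  have "sets (average_measure M \<mu>) = sigma_sets ?\<Omega> ?\<S>"
    unfolding average_measure_def by (rule sets_measure_of) auto
  moreover have "Pair i -` B \<in> sets (\<mu> i)" if "B \<in> sigma_sets ?\<Omega> ?\<S>" for B
    using that
  proof induction
    case (Compl B)
    have "Pair i -` (?\<Omega> - B) = space (\<mu> i) - Pair i -` B"
      using i by (auto simp: disjoint_union_def)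
    then show ?case using Compl by simp
  next
    case (Union B)
    then show ?case by (simp add: vimage_UN sets.countable_UN')
  qed (use i in auto)
  ultimately have slice: "Pair i -` B \<in> sets (\<mu> i)" if "B \<in> sets (average_measure M \<mu>)" for B
    using that by simp
  have "Pair i \<in> measurable (\<mu> i) (average_measure M \<mu>)"
  proof (rule measurableI)
    show "Pair i x \<in> space (average_measure M \<mu>)" if "x \<in> space (\<mu> i)" for x
      using that i by (simp add: space disjoint_union_def)
    show "Pair i -` B \<inter> space (\<mu> i) \<in> sets (\<mu> i)" if "B \<in> sets (average_measure M \<mu>)" for B
      using slice[OF that] by auto
  qed
  from measurable_compose[OF this f] show ?thesis .
qed

text \<open>
  Beyond the last eigenfunction \<open>ef r\<close> is arbitrary, but the eigenvalue 0 makes the feature vanish.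
\<close>

lemma mercer_feature_measurable:
  assumes mercer: "mercer_decomposition \<rho> S K lam ef" and r: "r \<ge> 1"
  shows "feature lam ef r \<in> borel_measurable \<rho>"
proof -
  obtain N :: enat where N: "\<forall>r. N < enat r \<longrightarrow> lam r = 0"
      "\<forall>r\<ge>1. enat r \<le> N \<longrightarrow> ef r \<in> borel_measurable \<rho>"
    using mercer unfolding mercer_decomposition_def by blast
  show ?thesis
  proof (cases "enat r \<le> N")
    case True
    then have [measurable]: "ef r \<in> borel_measurable \<rho>" using N(2) r by blast
    show ?thesis unfolding feature_def by measurable
  next
    case False
    then have "feature lam ef r = (\<lambda>_. 0)" using N(1) by (simp add: feature_def not_le fun_eq_iff)
    then show ?thesis by simp
  qed
qed

text \<open>
  The squared norm is a partial sum of the Mercer series of \<open>K x x\<close>, whose terms are nonnegative.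
\<close>

lemma mercer_feature_L2_le:
  assumes mercer: "mercer_decomposition \<rho> S K lam ef" and x: "x \<in> S"
    and diag: "K x x \<le> \<kappa>\<^sup>2" and \<kappa>: "\<kappa> \<ge> 0"
  shows "L2_set (\<lambda>r. feature lam ef r x) {1..R} \<le> \<kappa>"
proof -
  have lam: "\<And>r. r \<ge> 1 \<Longrightarrow> lam r \<ge> 0"
    and sums: "(\<lambda>n. lam (Suc n) * ef (Suc n) x * ef (Suc n) x) sums K x x"
    using mercer x unfolding mercer_decomposition_def by blast+
  have sq: "(feature lam ef r x)\<^sup>2 = lam r * ef r x * ef r x" if "r \<ge> 1" for r
    using lam[OF that] by (simp add: feature_def power2_eq_square)
  have "(\<Sum>r=1..R. (feature lam ef r x)\<^sup>2) = (\<Sum>r=1..R. lam r * ef r x * ef r x)"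
    by (intro sum.cong sq) auto
  also have "\<dots> = (\<Sum>n<R. lam (Suc n) * ef (Suc n) x * ef (Suc n) x)"
    using sum.atLeast1_atMost_eq by simp
  also have "\<dots> \<le> K x x"
  proof -
    have "0 \<le> lam (Suc n) * ef (Suc n) x * ef (Suc n) x" for n
      using lam[of "Suc n"] by (simp add: mult.assoc)
    then show ?thesis
      using sum_le_suminf[OF sums_summable[OF sums], of "{..<R}"] sums_unique[OF sums] by simp
  qed
  also note diag
  finally show ?thesis unfolding L2_set_def by (rule real_le_lsqrt[OF \<kappa>])
qed

theorem theorem3:
  fixes M R :: nat and \<epsilon> \<sigma> \<kappa> :: real
    and d :: "nat \<Rightarrow> nat" and X :: "nat \<Rightarrow> (nat \<Rightarrow> real) set"
    and \<mu> :: "nat \<Rightarrow> (nat \<Rightarrow> real) measure"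
    and Z :: "(real ^ 'd) set" and \<nu> :: "(real ^ 'd) measure"
    and K :: "nat \<times> (nat \<Rightarrow> real) \<Rightarrow> nat \<times> (nat \<Rightarrow> real) \<Rightarrow> real"
    and lam :: "nat \<Rightarrow> real" and ef :: "nat \<Rightarrow> nat \<times> (nat \<Rightarrow> real) \<Rightarrow> real"
    and \<phi> :: "nat \<Rightarrow> nat \<times> (nat \<Rightarrow> real) \<Rightarrow> real"
  assumes "M \<ge> 1" and "R \<ge> 1" and "\<epsilon> > 0" and "\<sigma> > 0"
    and "\<And>i. i \<in> {1..M} \<Longrightarrow> X i \<subseteq> space (euclid (d i))"
    and "\<And>i. i \<in> {1..M} \<Longrightarrow> \<mu> i \<in> prob_on (euclid (d i)) (X i)"
    and "\<nu> \<in> prob_on borel Z"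
    and "four_sub_Weibull (\<sigma>\<^sup>2) \<nu>"
    and "kernel_assumption M X \<mu> K lam ef \<kappa>"
    and "\<phi> = feature lam ef"
  shows "rank_objective M R \<epsilon> \<phi> \<mu> \<nu> = (INF A\<in>matrices R. lifted_objective M R \<epsilon> \<phi> \<mu> \<nu> A) \<and>
    (\<exists>A\<^sub>0\<in>matrices R. frob_norm R A\<^sub>0 \<le> M * \<kappa> * (2 * \<sigma>\<^sup>2) powr (1/4) \<and>
       lifted_objective M R \<epsilon> \<phi> \<mu> \<nu> A\<^sub>0 = (INF A\<in>matrices R. lifted_objective M R \<epsilon> \<phi> \<mu> \<nu> A))"
proof -
  note X_space = assms(5) and mu = assms(6)
  let ?S = "disjoint_union M X"
  have mercer: "mercer_decomposition (average_measure M \<mu>) ?S K lam ef"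
    and \<kappa>: "\<kappa> > 0" and diag: "\<And>x. x \<in> ?S \<Longrightarrow> K x x \<le> \<kappa>\<^sup>2"
    using assms(9) unfolding kernel_assumption_def Let_def by auto
  have mu_prob: "prob_space (\<mu> i)" and mu_space: "space (\<mu> i) = X i" if i: "i \<in> {1..M}" for i
  proof -
    have "sets (\<mu> i) = sets (restrict_space (euclid (d i)) (X i))"
      using mu[OF i] by (simp add: prob_on_def)
    from sets_eq_imp_space_eq[OF this] show "space (\<mu> i) = X i"
      using X_space[OF i] by (auto simp: space_restrict_space)
    show "prob_space (\<mu> i)" using mu[OF i] by (simp add: prob_on_def)
  qed
  have nu_prob: "prob_space \<nu>" and nu_sets: "sets \<nu> = sets (restrict_space borel Z)"
    using assms(7) by (auto simp: prob_on_def)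
  have nu_borel: "(\<lambda>z. z) \<in> borel_measurable \<nu>"
    unfolding measurable_cong_sets[OF nu_sets refl] by (rule measurable_restrict_space1) simp
  have "\<sigma>\<^sup>2 > 0" using assms(4) by simp
  note moments = sub_Weibull_moments[OF nu_prob nu_borel this assms(8)]
  interpret bounded_features M R \<epsilon> \<kappa> "(2 * \<sigma>\<^sup>2) powr (1/4)" \<phi> \<mu> \<nu>
  proof (rule bounded_features.intro)
    fix i assume i: "i \<in> {1..M}"
    show "prob_space (\<mu> i)" by (rule mu_prob[OF i])
    show "(\<lambda>x. \<phi> r (i, x)) \<in> borel_measurable (\<mu> i)" if "r \<in> {1..R}" for r
      using that mercer_feature_measurable[OF mercer, of r] i
      unfolding assms(10) by (intro measurable_average_measure_slice) auto
    show "L2_set (\<lambda>r. \<phi> r (i, x)) {1..R} \<le> \<kappa>" if "x \<in> space (\<mu> i)" for x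
    proof -
      have "(i, x) \<in> ?S" using that i by (simp add: mu_space disjoint_union_def)
      then show ?thesis
        unfolding assms(10) using diag \<kappa> by (intro mercer_feature_L2_le[OF mercer]) auto
    qed
  qed (use assms(3) \<kappa> nu_prob nu_borel moments in auto)
  show ?thesis using rank_objective_eq_INF_lifted lifted_minimiser_exists by blast
qed

end
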